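(* The best positive constants $p'$ and $q'$ such that $$\left(\frac{\sinh x}{x}\right)^{p'}<\frac{2}{\cos x+1}<\left(\frac{\sinh x}{x}\right)^{q'}\qquad\text{for all } x\in\left(0,\frac{\pi}{2}\right)$$ are $p'=\frac32$ and $q'=\frac{\ln 2}{\ln\left(\frac{\sinh(\pi/2)}{\pi/2}\right)}$. That is, $\frac32$ is the greatest $p'>0$ for which the left inequality holds for all $x\in(0,\frac{\pi}{2})$, and $\frac{\ln 2}{\ln\left(\frac{\sinh(\pi/2)}{\pi/2}\right)}$ is the least $q'>0$ for which the right inequality holds for all $x\in(0,\frac{\pi}{2})$. *)

theory Defs
  imports Complex_Main
begin

definition left_exponents :: "real set" where
  "left_exponents =
    {p. p > 0 \<and> (\<forall>x\<in>{0<..<pi/2}. (sinh x / x) powr p < 2 / (cos x + 1))}"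

definition right_exponents :: "real set" where
  "right_exponents =
    {q. q > 0 \<and> (\<forall>x\<in>{0<..<pi/2}. 2 / (cos x + 1) < (sinh x / x) powr q)}"

end

theory Submission
  imports Defs "HOL-Real_Asymp.Real_Asymp"
begin

text \<open>
  With \<open>f x = ln (2 / (cos x + 1))\<close> and \<open>g x = ln (sinh x / x)\<close> both exponents are extremal values
  of \<open>f / g\<close>. The function \<open>f x / x\<^sup>2\<close> increases because \<open>x f' - 2 f\<close> vanishes at \<open>0\<close> and has
  derivative \<open>(x - sin x) / (1 + cos x)\<close>, and \<open>g x / x\<^sup>2\<close> decreases because \<open>2 g - x g'\<close> vanishes
  at \<open>0\<close> and has derivative \<open>(x sinh x cosh x + x\<^sup>2 - 2 sinh\<^sup>2 x) / (x sinh\<^sup>2 x)\<close>. Hence \<open>f / g\<close>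
  increases strictly from its limit \<open>3/2\<close> at \<open>0\<close> to its value at \<open>\<pi>/2\<close>.
\<close>

text \<open>Monotonicity passes to the limit only as \<open>L \<le> h m\<close>; the intermediate
  point \<open>m\<close> restores strictness. A limit replaces the value at \<open>a\<close> because
  division by zero makes functions such as \<open>x * cosh x / sinh x\<close> and
  \<open>exponent_ratio\<close> discontinuous at 0.\<close>

lemma DERIV_pos_imp_right_limit_less:
  fixes h :: "real \<Rightarrow> real"
  assumes deriv: "\<And>y. a < y \<Longrightarrow> y \<le> x \<Longrightarrow> \<exists>D. DERIV h y :> D \<and> D > 0"
    and lim: "(h \<longlongrightarrow> L) (at_right a)" and "a < x"
  shows "L < h x"
proof -
  obtain m where m: "a < m" "m < x" using \<open>a < x\<close> dense by blast
  have incr: "h y < h z" if "a < y" "y < z" "z \<le> x" for y z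
    using that by (intro DERIV_pos_imp_increasing[OF \<open>y < z\<close>] deriv) auto
  have "\<forall>\<^sub>F y in at_right a. h y \<le> h m"
    using eventually_at_right_real[OF \<open>a < m\<close>]
    by eventually_elim (use incr m in \<open>auto intro: less_imp_le\<close>)
  then have "L \<le> h m"
    by (rule tendsto_upperbound[OF lim]) simp
  also have "\<dots> < h x" using incr m by simp
  finally show ?thesis .
qed

lemma sinh_real_gt_self:
  fixes t :: real
  assumes "0 < t"
  shows "t < sinh t"
proof -
  let ?h = "\<lambda>t. sinh t - t"
  have "0 < ?h t"
  proof (rule DERIV_pos_imp_right_limit_less[where a = 0 and L = 0 and h = ?h])
    show "\<exists>D. (?h has_real_derivative D) (at y) \<and> D > 0" if "0 < y" for y
      by (rule exI[of _ "cosh y - 1"])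
        (use that cosh_real_strict_mono[of 0 y] in \<open>auto intro!: derivative_eq_intros\<close>)
  qed (real_asymp, rule assms)
  then show ?thesis by simp
qed

text \<open>First link of a chain of four: in each of the next three lemmas, the difference of the
  two sides tends to 0 at 0 and its derivative is the difference treated in the lemma
  before.\<close>

lemma sinh_real_less_mult_cosh:
  fixes t :: real
  assumes "0 < t"
  shows "sinh t < t * cosh t"
proof -
  let ?h = "\<lambda>t. t * cosh t - sinh t"
  have "0 < ?h t"
  proof (rule DERIV_pos_imp_right_limit_less[where a = 0 and L = 0 and h = ?h])
    show "\<exists>D. (?h has_real_derivative D) (at y) \<and> D > 0" if "0 < y" for y
      by (rule exI[of _ "y * sinh y"]) (use that in \<open>auto intro!: derivative_eq_intros\<close>)
  qed (real_asymp, rule assms)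
  then show ?thesis by simp
qed

lemma cosh_real_less_mult_sinh:
  fixes t :: real
  assumes "0 < t"
  shows "2 * cosh t < t * sinh t + 2"
proof -
  let ?h = "\<lambda>t. t * sinh t + 2 - 2 * cosh t"
  have "0 < ?h t"
  proof (rule DERIV_pos_imp_right_limit_less[where a = 0 and L = 0 and h = ?h])
    show "\<exists>D. (?h has_real_derivative D) (at y) \<and> D > 0"
      if "0 < y" for y
      by (rule exI[of _ "y * cosh y - sinh y"])
        (use that sinh_real_less_mult_cosh in \<open>auto intro!: derivative_eq_intros\<close>)
  qed (real_asymp, rule assms)
  then show ?thesis by simp
qed

lemma sinh_real_less_mult_cosh_add:
  fixes t :: real
  assumes "0 < t"
  shows "3 * sinh t < t * cosh t + 2 * t"
proof -
  let ?h = "\<lambda>t. t * cosh t + 2 * t - 3 * sinh t"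
  have "0 < ?h t"
  proof (rule DERIV_pos_imp_right_limit_less[where a = 0 and L = 0 and h = ?h])
    show "\<exists>D. (?h has_real_derivative D) (at y) \<and> D > 0"
      if "0 < y" for y
      by (rule exI[of _ "y * sinh y + 2 - 2 * cosh y"])
        (use that cosh_real_less_mult_sinh in \<open>auto intro!: derivative_eq_intros\<close>)
  qed (real_asymp, rule assms)
  then show ?thesis by simp
qed

lemma cosh_real_less_mult_sinh_add_square:
  fixes t :: real
  assumes "0 < t"
  shows "4 * cosh t < t * sinh t + t\<^sup>2 + 4"
proof -
  let ?h = "\<lambda>t. t * sinh t + t\<^sup>2 + 4 - 4 * cosh t"
  have "0 < ?h t"
  proof (rule DERIV_pos_imp_right_limit_less[where a = 0 and L = 0 and h = ?h])
    show "\<exists>D. (?h has_real_derivative D) (at y) \<and> D > 0"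
      if "0 < y" for y
      by (rule exI[of _ "y * cosh y + 2 * y - 3 * sinh y"])
        (use that sinh_real_less_mult_cosh_add in \<open>auto intro!: derivative_eq_intros\<close>)
  qed (real_asymp, rule assms)
  then show ?thesis by simp
qed

text \<open>The end of the chain at \<open>t = 2 * x\<close>: the double argument formulas and
  \<open>cosh_square_eq\<close> turn it into four times this inequality. It gives the sign of the
  derivative in \<open>ln_sinh_quotient_growth\<close>.\<close>

lemma sinh_real_square_less:
  fixes x :: real
  assumes "0 < x"
  shows "2 * (sinh x)\<^sup>2 < x * sinh x * cosh x + x\<^sup>2"
  using cosh_real_less_mult_sinh_add_square[of "2 * x"] assms cosh_square_eq[of x]
  by (simp add: sinh_double cosh_double power_mult_distrib)

lemma ln_sinh_quotient_pos:
  fixes x :: real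
  assumes "0 < x"
  shows "0 < ln (sinh x / x)"
  using sinh_real_gt_self[OF assms] assms by simp

lemma cos_add_one_pos:
  fixes x :: real
  assumes "\<bar>x\<bar> < pi"
  shows "0 < cos x + 1"
  using cos_monotone_0_pi[of "\<bar>x\<bar>" pi] assms by simp

lemma sin_less_self:
  fixes x :: real
  assumes "0 < x" "x < pi"
  shows "sin x < x"
proof -
  let ?h = "\<lambda>x::real. x - sin x"
  have "0 < ?h x"
  proof (rule DERIV_pos_imp_right_limit_less[where a = 0 and L = 0 and h = ?h])
    show "\<exists>D. (?h has_real_derivative D) (at y) \<and> D > 0" if "0 < y" "y \<le> x" for y
      by (rule exI[of _ "1 - cos y"])
        (use that assms cos_monotone_0_pi[of 0 y] in \<open>auto intro!: derivative_eq_intros\<close>)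
  qed (real_asymp, rule assms)
  then show ?thesis by simp
qed

lemma DERIV_ln_sinh_quotient:
  fixes x :: real
  assumes "0 < x"
  shows "((\<lambda>x. ln (sinh x / x)) has_real_derivative cosh x / sinh x - 1 / x) (at x)"
  using assms by (auto intro!: derivative_eq_intros simp: field_simps)

lemma DERIV_ln_cos_quotient:
  fixes x :: real
  assumes "\<bar>x\<bar> < pi"
  shows "((\<lambda>x. ln (2 / (cos x + 1))) has_real_derivative sin x / (cos x + 1)) (at x)"
  using cos_add_one_pos[OF assms] by (auto intro!: derivative_eq_intros simp: divide_simps)

lemma ln_sinh_quotient_growth:
  fixes x :: real
  assumes "0 < x"
  shows "x * (cosh x / sinh x - 1 / x) < 2 * ln (sinh x / x)"
proof -
  \<comment> \<open>The summand 1 is the product \<open>x * (1 / x)\<close> from the right-hand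
    derivative term, cancelled in advance; it also makes the limit at 0 equal to 0.\<close>
  let ?h = "\<lambda>x::real. 2 * ln (sinh x / x) - x * cosh x / sinh x + 1"
  have "0 < ?h x"
  proof (rule DERIV_pos_imp_right_limit_less[where a = 0 and L = 0 and h = ?h])
    fix y :: real
    assume y: "0 < y"
    let ?D = "(y * sinh y * cosh y + y\<^sup>2 - 2 * (sinh y)\<^sup>2) / (y * (sinh y)\<^sup>2)"
    have "((\<lambda>x. x * cosh x / sinh x) has_real_derivative
        ((cosh y + y * sinh y) * sinh y - y * cosh y * cosh y) / (sinh y * sinh y)) (at y)"
      using y by (auto intro!: derivative_eq_intros)
    note D = DERIV_add[OF DERIV_diff[OF DERIV_cmult[OF DERIV_ln_sinh_quotient[OF y], of 2] this]
        DERIV_const[of 1]]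
    have "2 * (cosh y / sinh y - 1 / y) -
        ((cosh y + y * sinh y) * sinh y - y * cosh y * cosh y) / (sinh y * sinh y) + 0 = ?D"
      using y cosh_square_eq[of y] by (simp add: divide_simps) algebra
    with D have "(?h has_real_derivative ?D) (at y)"
      by simp
    moreover have "?D > 0" using y sinh_real_square_less[OF y] by simp
    ultimately show "\<exists>D. (?h has_real_derivative D) (at y) \<and> D > 0" by blast
  next
    show "(?h \<longlongrightarrow> 0) (at_right 0)"
      by real_asymp
  qed (rule assms)
  then show ?thesis using assms by (simp add: right_diff_distrib)
qed

lemma ln_cos_quotient_growth:
  fixes x :: real
  assumes "0 < x" "x < pi"
  shows "2 * ln (2 / (cos x + 1)) < x * (sin x / (cos x + 1))"
proof -
  let ?h = "\<lambda>x::real. x * (sin x / (cos x + 1)) - 2 * ln (2 / (cos x + 1))"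
  have "0 < ?h x"
  proof (rule DERIV_pos_imp_right_limit_less[where a = 0 and L = 0 and h = ?h])
    fix y :: real
    assume y: "0 < y" "y \<le> x"
    then have c: "0 < cos y + 1" using assms by (intro cos_add_one_pos) auto
    let ?D = "(y - sin y) / (cos y + 1)"
    \<comment> \<open>The numerator of the quotient rule for \<open>sin x / (cos x + 1)\<close>
      collapses to \<open>cos y + 1\<close>, which cancels one factor of the denominator.\<close>
    have "cos y * (cos y + 1) + sin y * sin y = cos y + 1"
      using sin_cos_squared_add[of y] by algebra
    with c have "((\<lambda>x. sin x / (cos x + 1)) has_real_derivative 1 / (cos y + 1)) (at y)"
      by (auto intro!: derivative_eq_intros)
    note q = DERIV_mult[OF DERIV_ident this]
    have "((\<lambda>x. 2 * ln (2 / (cos x + 1))) has_real_derivative 2 * (sin y / (cos y + 1))) (at y)"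
      using y assms by (intro DERIV_cmult DERIV_ln_cos_quotient) auto
    note D = DERIV_diff[OF q this]
    have "1 * (sin y / (cos y + 1)) + 1 / (cos y + 1) * y - 2 * (sin y / (cos y + 1)) = ?D"
      by (simp add: diff_divide_distrib)
    with D have "(?h has_real_derivative ?D) (at y)" by (simp only:)
    moreover have "?D > 0" using c sin_less_self[OF y(1)] y(2) assms by simp
    ultimately show "\<exists>D. (?h has_real_derivative D) (at y) \<and> D > 0" by blast
  next
    show "(?h \<longlongrightarrow> 0) (at_right 0)"
      by real_asymp
  qed (rule assms)
  then show ?thesis by simp
qed

text \<open>For \<open>0 < x < pi\<close> this is the exponent \<open>p\<close> at which
  \<open>(sinh x / x) powr p\<close> equals \<open>2 / (cos x + 1)\<close>.\<close>

definition exponent_ratio :: "real \<Rightarrow> real" where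
  "exponent_ratio x = ln (2 / (cos x + 1)) / ln (sinh x / x)"

text \<open>The sign is that of \<open>?f' * ?g - ?f * ?g'\<close>. After multiplication by
  \<open>x\<close>, the two growth lemmas compare both products with \<open>2 * ?f * ?g\<close>. The
  range up to \<open>pi\<close> makes \<open>pi/2\<close> an interior point, so that the ratio is
  continuous there.\<close>

lemma DERIV_exponent_ratio_pos:
  assumes "0 < x" "x < pi"
  shows "\<exists>D. DERIV exponent_ratio x :> D \<and> D > 0"
proof -
  let ?f = "ln (2 / (cos x + 1))" and ?g = "ln (sinh x / x)"
  let ?f' = "sin x / (cos x + 1)" and ?g' = "cosh x / sinh x - 1 / x"
  have g: "0 < ?g" using assms by (intro ln_sinh_quotient_pos)
  have "cos x < 1" using cos_monotone_0_pi[of 0 x] assms by simp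
  moreover have "0 < cos x + 1" using assms by (intro cos_add_one_pos) auto
  ultimately have f: "0 < ?f" by simp
  have "(exponent_ratio has_real_derivative (?f' * ?g - ?f * ?g') / (?g * ?g)) (at x)"
    unfolding exponent_ratio_def
    using assms g by (intro DERIV_divide DERIV_ln_cos_quotient DERIV_ln_sinh_quotient) auto
  moreover have "?f * (x * ?g') < (x * ?f') * ?g"
  proof -
    have "?f * (x * ?g') < ?f * (2 * ?g)"
      using ln_sinh_quotient_growth[OF assms(1)] f by (intro mult_strict_left_mono)
    also have "\<dots> = (2 * ?f) * ?g" by simp
    also have "\<dots> < (x * ?f') * ?g"
      using ln_cos_quotient_growth[OF assms] g by (intro mult_strict_right_mono)
    finally show ?thesis .
  qed
  then have "x * (?f * ?g') < x * (?f' * ?g)" by (simp only: ac_simps)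
  then have "?f * ?g' < ?f' * ?g" using assms(1) by (simp only: mult_less_cancel_left_pos)
  ultimately show ?thesis using g by (meson diff_gt_0_iff_gt divide_pos_pos mult_pos_pos)
qed

text \<open>Near 0 the numerator behaves like \<open>x\<^sup>2 / 4\<close> and the denominator like
  \<open>x\<^sup>2 / 6\<close>.\<close>

lemma exponent_ratio_tendsto: "(exponent_ratio \<longlongrightarrow> 3/2) (at_right 0)"
  unfolding exponent_ratio_def by real_asymp

lemma exponent_ratio_pi_half: "exponent_ratio (pi/2) = ln 2 / ln (sinh (pi/2) / (pi/2))"
  by (simp add: exponent_ratio_def)

text \<open>Take logarithms and divide by \<open>ln (sinh x / x)\<close>, which is positive and so
  preserves the direction of the inequality.\<close>

lemma powr_less_iff_less_exponent_ratio:
  assumes "0 < x" "x < pi"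
  shows "(sinh x / x) powr p < 2 / (cos x + 1) \<longleftrightarrow> p < exponent_ratio x"
    and "2 / (cos x + 1) < (sinh x / x) powr p \<longleftrightarrow> exponent_ratio x < p"
proof -
  have g: "0 < ln (sinh x / x)" using assms by (intro ln_sinh_quotient_pos)
  have "0 < cos x + 1" using assms by (intro cos_add_one_pos) auto
  then have *: "0 < 2 / (cos x + 1)" by simp
  have **: "(sinh x / x) powr p = exp (p * ln (sinh x / x))"
    using assms by (simp add: powr_def)
  have "2 / (cos x + 1) = exp (ln (2 / (cos x + 1)))" using * by simp
  then show "(sinh x / x) powr p < 2 / (cos x + 1) \<longleftrightarrow> p < exponent_ratio x"
    and "2 / (cos x + 1) < (sinh x / x) powr p \<longleftrightarrow> exponent_ratio x < p"
    unfolding ** exponent_ratio_def pos_less_divide_eq[OF g] pos_divide_less_eq[OF g]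
    by (metis exp_less_cancel_iff)+
qed

lemma left_exponents_eq:
  "left_exponents = {p. p > 0 \<and> (\<forall>x\<in>{0<..<pi/2}. p < exponent_ratio x)}"
  unfolding left_exponents_def by (simp add: powr_less_iff_less_exponent_ratio)

lemma right_exponents_eq:
  "right_exponents = {q. q > 0 \<and> (\<forall>x\<in>{0<..<pi/2}. exponent_ratio x < q)}"
  unfolding right_exponents_def by (simp add: powr_less_iff_less_exponent_ratio)

theorem theorem2p2:
  shows "(3/2 \<in> left_exponents \<and> (\<forall>p\<in>left_exponents. p \<le> 3/2)) \<and>
    (ln 2 / ln (sinh (pi/2) / (pi/2)) \<in> right_exponents \<and>
     (\<forall>q\<in>right_exponents. ln 2 / ln (sinh (pi/2) / (pi/2)) \<le> q))"
  unfolding exponent_ratio_pi_half[symmetric]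
proof (intro conjI ballI)
  have lower: "3/2 < exponent_ratio x" if "0 < x" "x < pi" for x
    using that
    by (intro DERIV_pos_imp_right_limit_less[OF _ exponent_ratio_tendsto] DERIV_exponent_ratio_pos)
      auto
  then show "3/2 \<in> left_exponents" by (simp add: left_exponents_eq)
  have "exponent_ratio x < exponent_ratio (pi/2)" if "0 < x" "x < pi/2" for x
    using that(2) by (rule DERIV_pos_imp_increasing) (use that DERIV_exponent_ratio_pos in auto)
  \<comment> \<open>Right exponents must be positive; the lower bound 3/2 holds at
    \<open>pi/2\<close> too.\<close>
  moreover have "0 < exponent_ratio (pi/2)" using lower[of "pi/2"] by simp
  ultimately show "exponent_ratio (pi/2) \<in> right_exponents" by (simp add: right_exponents_eq)
next
  fix p assume "p \<in> left_exponents"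
  \<comment> \<open>An admissible \<open>p\<close> lies below the ratio throughout the interval,
    hence is at most its limit at 0.\<close>
  then have "\<forall>\<^sub>F x in at_right 0. p \<le> exponent_ratio x"
    using eventually_at_right_real[of 0 "pi/2"]
    by (auto simp: left_exponents_eq less_imp_le elim!: eventually_mono)
  then show "p \<le> 3/2"
    by (rule tendsto_lowerbound[OF exponent_ratio_tendsto]) simp
next
  fix q assume "q \<in> right_exponents"
  then have *: "\<forall>\<^sub>F x in at_left (pi/2). exponent_ratio x \<le> q"
    using eventually_at_left_real[of 0 "pi/2"]
    by (auto simp: right_exponents_eq less_imp_le elim!: eventually_mono)
  \<comment> \<open>The open interval leaves out \<open>pi/2\<close>, so the bound by
    \<open>q\<close> reaches the value there only through continuity from the left.\<close>
  have "isCont exponent_ratio (pi/2)"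
    using DERIV_exponent_ratio_pos[of "pi/2"] by (auto dest: DERIV_isCont)
  then have "(exponent_ratio \<longlongrightarrow> exponent_ratio (pi/2)) (at_left (pi/2))"
    by (simp add: isCont_def filterlim_at_split)
  from tendsto_upperbound[OF this *] show "exponent_ratio (pi/2) \<le> q" by simp
qed

end
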